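(* Let $T\in\mathcal{B}^{0,1}(V_n)$ and let $M\ge1$ be an integer. For $\mathrm{j}\in\mathbb{S}$ set $ds_{\mathrm{j}}=ds\,(-\mathrm{j})$ and $\overline{\partial_{\mathrm{j}}}=\frac12(\partial_u+\mathrm{j}\partial_v)$. Then, for every $F(s)=\sum_{\ell=0}^{M-1}\overline{s}^\ell f_\ell(s)\in\mathcal{PS}^M_L(\sigma_S(T))$ (with $f_\ell$ the left slice monogenic components of $F$), $$\frac{1}{2\pi}\int_{\partial(U\cap\mathbb{C}_{\mathrm{j}})}\sum_{\ell=0}^{M-1}\Pi_\ell S_L^{-1}(s,T)\,ds_{\mathrm{j}}\,\overline{\partial_{\mathrm{j}}}^{\,\ell}F(s)=\frac{1}{2\pi}\int_{\partial(U\cap\mathbb{C}_{\mathrm{j}})}\sum_{\ell=0}^{M-1}\overline{T}^\ell S_L^{-1}(s,T)\,ds_{\mathrm{j}}\,f_\ell(s),$$ and, for every $F(s)=\sum_{\ell=0}^{M-1}f_\ell(s)\overline{s}^\ell\in\mathcal{PS}^M_R(\sigma_S(T))$ (with $f_\ell$ the right slice monogenic components of $F$), $$\frac{1}{2\pi}\int_{\partial(U\cap\mathbb{C}_{\mathrm{j}})}\sum_{\ell=0}^{M-1}F(s)\overline{\partial_{\mathrm{j}}}^{\,\ell}\,ds_{\mathrm{j}}\,\Pi_\ell S_R^{-1}(s,T)=\frac{1}{2\pi}\int_{\partial(U\cap\mathbb{C}_{\mathrm{j}})}\sum_{\ell=0}^{M-1}f_\ell(s)\,ds_{\mathrm{j}}\,S_R^{-1}(s,T)\overline{T}^\ell.$$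 Here $U$ is any bounded slice Cauchy domain with $\sigma_S(T)\subset U$ and $\overline U\subset\mathrm{dom}(F)$.
   Context: $\mathbb{R}_n$ is the real Clifford algebra generated by $e_1,\dots,e_n$ with $e_\ell e_m+e_me_\ell=0$ ($\ell\ne m$), $e_\ell^2=-1$, with basis $e_A$. A point of $\mathbb{R}^{n+1}$ is identified with the paravector $x=x_0+\sum_{\ell=1}^n x_\ell e_\ell$; $\mathrm{Re}(x)=x_0$, $\overline{x}=x_0-\sum x_\ell e_\ell$. $\mathbb{S}=\{\sum_{\ell=1}^n x_\ell e_\ell:\sum x_\ell^2=1\}$; $\mathbb{C}_{\mathrm{j}}=\mathbb{R}+\mathrm{j}\mathbb{R}$ for $\mathrm{j}\in\mathbb{S}$. For $x=x_0+\underline{x}$, $[x]=\{x_0+\mathrm{j}|\underline{x}|:\mathrm{j}\in\mathbb{S}\}$; $U$ is axially symmetric if $[x]\subset U$ for all $x\in U$. For $U$ axially symmetric open and $\mathcal{U}=\{(u,v):u+\mathbb{S}v\subset U\}$, $F:U\to\mathbb{R}_n$ is left (right) poly slice monogenic of order $M$ if $F(u+\mathrm{j}v)=F_0(u,v)+\mathrm{j}F_1(u,v)$ (resp. $F_0(u,v)+F_1(u,v)\mathrm{j}$) for all $\mathrm{j}\in\mathbb{S}$, with $F_0,F_1:\mathcal{U}\to\mathbb{R}_n$ of class $\mathcal{C}^M$, $F_0$ even and $F_1$ odd in $v$, and $\frac{1}{2^M}(\partial_u+\mathrm{j}\partial_v)^M(F_0+\mathrm{j}F_1)=0$ (resp.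 $(F_0+F_1\mathrm{j})\frac{1}{2^M}(\partial_u+\mathrm{j}\partial_v)^M=0$, $\mathrm{j}$ acting from the right) for all $\mathrm{j}\in\mathbb{S}$. Order $1$ gives left (right) slice monogenic functions. Each such $F$ has a unique decomposition $F(x)=\sum_{k=0}^{M-1}\overline{x}^kf_k(x)$ (resp. $\sum_{k=0}^{M-1} f_k(x)\overline{x}^k$) with left (right) slice monogenic $f_k$, the components of $F$. In the integrals $s=u+\mathrm{j}v\in\mathbb{C}_{\mathrm{j}}$, $\overline{\partial_{\mathrm{j}}}F=\frac12(\partial_uF+\mathrm{j}\partial_vF)$, $F\overline{\partial_{\mathrm{j}}}=\frac12(\partial_uF+(\partial_vF)\mathrm{j})$. A slice Cauchy domain is an axially symmetric open set $U$ such that for every $\mathrm{j}\in\mathbb{S}$ the boundary $\partial(U\cap\mathbb{C}_{\mathrm{j}})$ is a finite union of non-intersecting piecewise continuously differentiable Jordan curves (positively oriented). $V$ is a real Banach space, $V_n=V\otimes\mathbb{R}_n$ with elements $\sum_Av_Ae_A$ and $\|v\|^2=\sum_A\|v_A\|^2$, a two-sided $\mathbb{R}_n$-module. $\mathcal{B}(V_n)$ is the set of Clifford operators $T=\sum_Ae_AT_A$, $T_A$ bounded linear on $V$, acting by $T(\sum_B v_Be_B)=\sum_{A,B}T_A(v_B)e_Ae_B$, with norm $\|T\|=\sum_A\|T_A\|$; for $a\in\mathbb{R}_n$, $(aT)(v)=a\,T(v)$, $(Ta)(v)=T(av)$. $\mathcal{B}^{0,1}(V_n)$ is the set of paravector operators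 $T=T_0+\sum_{j=1}^ne_jT_j$ (components not assumed to commute); $\overline{T}=T_0-\sum_{j=1}^ne_jT_j$. For $s\in\mathbb{R}^{n+1}$: $\mathcal{Q}_s(T)=T^2-2\mathrm{Re}(s)T+|s|^2\mathcal{I}$; $\rho_S(T)=\{s\in\mathbb{R}^{n+1}:\mathcal{Q}_s(T)\text{ invertible in }\mathcal{B}(V_n)\}$, $\sigma_S(T)=\mathbb{R}^{n+1}\setminus\rho_S(T)$. For $s\in\rho_S(T)$: $S_L^{-1}(s,T)=-\mathcal{Q}_s(T)^{-1}(T-\overline{s}\mathcal{I})$, $S_R^{-1}(s,T)=-(T-\overline{s}\mathcal{I})\mathcal{Q}_s(T)^{-1}$, and $$\Pi_\ell S_L^{-1}(s,T)=\frac1{\ell!}\sum_{k=0}^\ell\binom{\ell}{k}\overline{T}^kS_L^{-1}(s,T)(-\overline{s})^{\ell-k},\quad \Pi_\ell S_R^{-1}(s,T)=\frac1{\ell!}\sum_{k=0}^\ell\binom{\ell}{k}(-\overline{s})^{\ell-k}S_R^{-1}(s,T)\overline{T}^k.$$ $\mathcal{PS}^M_L(\sigma_S(T))$, $\mathcal{PS}^M_R(\sigma_S(T))$ denote the left, resp. right, poly slice monogenic functions $F$ of order $M$ on an axially symmetric open set $\mathrm{dom}(F)$ for which there is a bounded slice Cauchy domain $U$ with $\sigma_S(T)\subset U$, $\overline U\subset\mathrm{dom}(F)$. *)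

theory Defs
  imports "HOL-Complex_Analysis.Winding_Numbers"
begin

section \<open>The Banach algebra of bounded operators on a real Banach space\<close>

text \<open>
  A copy of \<open>'v \<Rightarrow>\<^sub>L 'v\<close> on which composition is available as \<open>*\<close>. It is not made an instance of
  \<open>real_normed_algebra_1\<close> because \<open>0 \<noteq> 1\<close> fails on the zero space.
\<close>

typedef (overloaded) 'v endo = "UNIV :: ('v::real_normed_vector \<Rightarrow>\<^sub>L 'v) set"
  morphisms blinfun_of_endo Endo ..

setup_lifting type_definition_endo

lemma endo_eqI: "blinfun_of_endo S = blinfun_of_endo T \<Longrightarrow> S = T"
  by (simp add: blinfun_of_endo_inject)

instantiation endo :: (real_normed_vector) real_normed_vector
begin

lift_definition zero_endo :: "'a endo" is 0 .
lift_definition plus_endo :: "'a endo \<Rightarrow> 'a endo \<Rightarrow> 'a endo" is "(+)" .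
lift_definition minus_endo :: "'a endo \<Rightarrow> 'a endo \<Rightarrow> 'a endo" is "(-)" .
lift_definition uminus_endo :: "'a endo \<Rightarrow> 'a endo" is uminus .
lift_definition scaleR_endo :: "real \<Rightarrow> 'a endo \<Rightarrow> 'a endo" is scaleR .
lift_definition norm_endo :: "'a endo \<Rightarrow> real" is norm .
definition dist_endo :: "'a endo \<Rightarrow> 'a endo \<Rightarrow> real" where
  "dist_endo S T = norm (S - T)"
definition sgn_endo :: "'a endo \<Rightarrow> 'a endo" where
  "sgn_endo T = scaleR (inverse (norm T)) T"
definition uniformity_endo :: "('a endo \<times> 'a endo) filter" where
  "uniformity_endo = (INF e\<in>{0 <..}. principal {(x, y). dist x y < e})"
definition open_endo :: "'a endo set \<Rightarrow> bool" where
  "open_endo U = (\<forall>x\<in>U. \<forall>\<^sub>F (x', y) in uniformity. x' = x \<longrightarrow> y \<in> U)"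

instance
proof
  fix S T R :: "'a endo" and r q :: real
  show "S + T + R = S + (T + R)" "S + T = T + S" "0 + S = S" "- S + S = 0" "S - T = S + - T"
    "r *\<^sub>R (S + T) = r *\<^sub>R S + r *\<^sub>R T" "(r + q) *\<^sub>R S = r *\<^sub>R S + q *\<^sub>R S"
    "r *\<^sub>R q *\<^sub>R S = (r * q) *\<^sub>R S" "1 *\<^sub>R S = S"
    by (transfer, simp add: scaleR_add_left scaleR_add_right)+
  show "norm S = 0 \<longleftrightarrow> S = 0" "norm (S + T) \<le> norm S + norm T" "norm (r *\<^sub>R S) = \<bar>r\<bar> * norm S"
    by (transfer, simp add: norm_triangle_ineq)+
qed (rule dist_endo_def sgn_endo_def uniformity_endo_def open_endo_def)+

end

instantiation endo :: (real_normed_vector) "{real_normed_algebra, monoid_mult}"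
begin

lift_definition one_endo :: "'a endo" is id_blinfun .
lift_definition times_endo :: "'a endo \<Rightarrow> 'a endo \<Rightarrow> 'a endo" is blinfun_compose .

instance
proof
  fix R S T :: "'a endo" and r :: real
  show "R * S * T = R * (S * T)" "1 * T = T" "T * 1 = T"
    "(R + S) * T = R * T + S * T" "R * (S + T) = R * S + R * T"
    "r *\<^sub>R S * T = r *\<^sub>R (S * T)" "S * r *\<^sub>R T = r *\<^sub>R (S * T)"
    by (rule endo_eqI, rule blinfun_eqI, simp add: times_endo.rep_eq one_endo.rep_eq
        plus_endo.rep_eq scaleR_endo.rep_eq blinfun.bilinear_simps)+
  show "norm (S * T) \<le> norm S * norm T"
    by (simp add: times_endo.rep_eq norm_endo.rep_eq norm_blinfun_compose)
qed

end

instance endo :: (banach) banach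
proof
  fix X :: "nat \<Rightarrow> 'a endo"
  assume "Cauchy X"
  have d: "dist S T = dist (blinfun_of_endo S) (blinfun_of_endo T)" for S T :: "'a endo"
    by (simp add: dist_endo_def dist_norm norm_endo.rep_eq minus_endo.rep_eq)
  from \<open>Cauchy X\<close> have "Cauchy (\<lambda>n. blinfun_of_endo (X n))"
    unfolding Cauchy_def d .
  then obtain L where "(\<lambda>n. blinfun_of_endo (X n)) \<longlonglongrightarrow> L"
    using Cauchy_convergent convergent_def by blast
  then have "X \<longlonglongrightarrow> Endo L"
    unfolding lim_sequentially d by (simp add: Endo_inverse)
  then show "convergent X"
    using convergent_def by blast
qed


section \<open>Clifford algebras\<close>

text \<open>
  \<open>('a, 'n) clifford\<close> is \<open>'a \<otimes> \<real>\<^sub>n\<close> with \<open>n = CARD('n)\<close>: the elements \<open>\<Sum>\<^sub>A x\<^sub>A e\<^sub>A\<close>, where the index set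
  \<open>A\<close> runs over the subsets of \<open>'n\<close>. The order on \<open>'n\<close> fixes the order of the factors in \<open>e\<^sub>A\<close>.
  The coefficient type \<open>real\<close> gives \<open>\<real>\<^sub>n\<close>, and \<open>'v endo\<close> gives the Clifford operators on \<open>V\<^sub>n\<close>.
\<close>

typedef ('a, 'n) clifford = "UNIV :: ('n set \<Rightarrow> 'a) set"
  morphisms ccoeff Clifford ..

type_synonym 'n cl = "(real, 'n) clifford"
type_synonym ('v, 'n) clop = "('v endo, 'n) clifford"

setup_lifting type_definition_clifford

lemma clifford_eqI: "(\<And>A. ccoeff x A = ccoeff y A) \<Longrightarrow> x = y"
  by (metis ccoeff_inject ext)

text \<open>
  \<open>e\<^sub>A e\<^sub>B = cl_sign A B \<cdot> e\<^bsub>A \<triangle> B\<^esub>\<close>: moving the factors into increasing order produces a sign for every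
  pair \<open>a > b\<close>, and each common factor \<open>a = b\<close> contributes \<open>e\<^sub>a\<^sup>2 = -1\<close>.
\<close>

definition cl_sign :: "'n::{finite,linorder} set \<Rightarrow> 'n set \<Rightarrow> real" where
  "cl_sign A B = (-1) ^ card {(a, b). a \<in> A \<and> b \<in> B \<and> b \<le> a}"

instantiation clifford :: (real_normed_vector, finite) real_normed_vector
begin

lift_definition zero_clifford :: "('a, 'b) clifford" is "\<lambda>_. 0" .
lift_definition plus_clifford :: "('a, 'b) clifford \<Rightarrow> ('a, 'b) clifford \<Rightarrow> ('a, 'b) clifford"
  is "\<lambda>x y A. x A + y A" .
lift_definition minus_clifford :: "('a, 'b) clifford \<Rightarrow> ('a, 'b) clifford \<Rightarrow> ('a, 'b) clifford"
  is "\<lambda>x y A. x A - y A" .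
lift_definition uminus_clifford :: "('a, 'b) clifford \<Rightarrow> ('a, 'b) clifford"
  is "\<lambda>x A. - x A" .
lift_definition scaleR_clifford :: "real \<Rightarrow> ('a, 'b) clifford \<Rightarrow> ('a, 'b) clifford"
  is "\<lambda>r x A. r *\<^sub>R x A" .
lift_definition norm_clifford :: "('a, 'b) clifford \<Rightarrow> real"
  is "\<lambda>x. \<Sum>A\<in>UNIV. norm (x A)" .
definition dist_clifford :: "('a, 'b) clifford \<Rightarrow> ('a, 'b) clifford \<Rightarrow> real" where
  "dist_clifford x y = norm (x - y)"
definition sgn_clifford :: "('a, 'b) clifford \<Rightarrow> ('a, 'b) clifford" where
  "sgn_clifford x = scaleR (inverse (norm x)) x"
definition uniformity_clifford :: "(('a, 'b) clifford \<times> ('a, 'b) clifford) filter" where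
  "uniformity_clifford = (INF e\<in>{0 <..}. principal {(x, y). dist x y < e})"
definition open_clifford :: "('a, 'b) clifford set \<Rightarrow> bool" where
  "open_clifford U = (\<forall>x\<in>U. \<forall>\<^sub>F (x', y) in uniformity. x' = x \<longrightarrow> y \<in> U)"

instance
proof
  fix x y z :: "('a, 'b) clifford" and r q :: real
  show "norm (x + y) \<le> norm x + norm y"
    by transfer (simp add: sum.distrib[symmetric] sum_mono norm_triangle_ineq)
  show "norm x = 0 \<longleftrightarrow> x = 0"
    by transfer (auto simp: sum_nonneg_eq_0_iff fun_eq_iff)
  show "norm (r *\<^sub>R x) = \<bar>r\<bar> * norm x"
    by transfer (simp add: sum_distrib_left)
  show "x + y + z = x + (y + z)" "x + y = y + x" "0 + x = x" "- x + x = 0" "x - y = x + - y"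
    "r *\<^sub>R (x + y) = r *\<^sub>R x + r *\<^sub>R y" "(r + q) *\<^sub>R x = r *\<^sub>R x + q *\<^sub>R x"
    "r *\<^sub>R q *\<^sub>R x = (r * q) *\<^sub>R x" "1 *\<^sub>R x = x"
    by (transfer, simp add: scaleR_add_left scaleR_add_right fun_eq_iff add_ac)+
qed (rule dist_clifford_def sgn_clifford_def uniformity_clifford_def open_clifford_def)+

end

lemma ccoeff_sum: "ccoeff (sum f I) A = (\<Sum>i\<in>I. ccoeff (f i) A)"
  by (induction I rule: infinite_finite_induct) (simp_all add: zero_clifford.rep_eq plus_clifford.rep_eq)

instance clifford :: (banach, finite) banach
proof
  fix X :: "nat \<Rightarrow> ('a, 'b) clifford"
  assume X: "Cauchy X"
  have le: "dist (ccoeff x A) (ccoeff y A) \<le> dist x y" for A and x y :: "('a, 'b) clifford"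
    unfolding dist_norm norm_clifford.rep_eq minus_clifford.rep_eq
    by (rule member_le_sum[where f = "\<lambda>A. norm (ccoeff x A - ccoeff y A)"]) auto
  have "Cauchy (\<lambda>n. ccoeff (X n) A)" for A
    using X unfolding Cauchy_def by (meson le le_less_trans)
  then have "\<forall>A. \<exists>l. (\<lambda>n. ccoeff (X n) A) \<longlonglongrightarrow> l"
    using Cauchy_convergent convergent_def by blast
  then obtain L where L: "\<And>A. (\<lambda>n. ccoeff (X n) A) \<longlonglongrightarrow> L A"
    by metis
  have "(\<lambda>n. \<Sum>A\<in>UNIV. norm (ccoeff (X n) A - L A)) \<longlonglongrightarrow> (\<Sum>A\<in>UNIV. norm (L A - L A))"
    by (intro tendsto_intros L)
  then have "(\<lambda>n. norm (X n - Clifford L)) \<longlonglongrightarrow> 0"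
    by (simp add: norm_clifford.rep_eq minus_clifford.rep_eq Clifford_inverse)
  then have "X \<longlonglongrightarrow> Clifford L"
    by (metis Lim_null tendsto_norm_zero_iff)
  then show "convergent X"
    using convergent_def by blast
qed

text \<open>The element \<open>a e\<^sub>A\<close>.\<close>

definition cmonom :: "'n set \<Rightarrow> 'a \<Rightarrow> ('a::zero, 'n) clifford" where
  "cmonom A a = Clifford (\<lambda>B. if B = A then a else 0)"

lemma ccoeff_cmonom: "ccoeff (cmonom A a) B = (if B = A then a else 0)"
  by (simp add: cmonom_def Clifford_inverse)

lemma clifford_expansion:
  fixes x :: "('a::real_normed_vector, 'n::finite) clifford"
  shows "x = (\<Sum>A\<in>UNIV. cmonom A (ccoeff x A))"
  by (rule clifford_eqI) (simp add: ccoeff_sum ccoeff_cmonom)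

lemma neg1_card_sym_diff:
  assumes "finite A" "finite B"
  shows "(-1::real) ^ card (sym_diff A B) = (-1) ^ card A * (-1) ^ card B"
proof -
  have a: "card A = card (A - B) + card (A \<inter> B)"
    using card_Diff_subset_Int[of A B] assms card_mono[of A "A \<inter> B"] by auto
  have b: "card B = card (B - A) + card (A \<inter> B)"
    using card_Diff_subset_Int[of B A] assms card_mono[of B "A \<inter> B"] by (auto simp: Int_commute)
  have "card (sym_diff A B) = card (A - B) + card (B - A)"
    using assms by (intro card_Un_disjoint) auto
  moreover have "(-1::real) ^ card (A \<inter> B) * (-1) ^ card (A \<inter> B) = 1"
    by (simp flip: power_mult_distrib)
  ultimately show ?thesis
    unfolding a b by (simp add: power_add mult_ac)
qed

lemma cl_sign_sym_diff_left: "cl_sign (sym_diff A B) C = cl_sign A C * cl_sign B C"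
proof -
  have "{(a, b). a \<in> sym_diff A B \<and> b \<in> C \<and> b \<le> a} =
      sym_diff {(a, b). a \<in> A \<and> b \<in> C \<and> b \<le> a} {(a, b). a \<in> B \<and> b \<in> C \<and> b \<le> a}"
    by auto
  then show ?thesis
    unfolding cl_sign_def by (simp only: neg1_card_sym_diff finite)
qed

lemma cl_sign_sym_diff_right: "cl_sign C (sym_diff A B) = cl_sign C A * cl_sign C B"
proof -
  have "{(a, b). a \<in> C \<and> b \<in> sym_diff A B \<and> b \<le> a} =
      sym_diff {(a, b). a \<in> C \<and> b \<in> A \<and> b \<le> a} {(a, b). a \<in> C \<and> b \<in> B \<and> b \<le> a}"
    by auto
  then show ?thesis
    unfolding cl_sign_def by (simp only: neg1_card_sym_diff finite)
qed

lemma cl_sign_empty [simp]: "cl_sign {} A = 1" "cl_sign A {} = 1"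
  by (simp_all add: cl_sign_def)

lemma abs_cl_sign [simp]: "\<bar>cl_sign A B\<bar> = 1"
  by (simp add: cl_sign_def)

lemma cl_sign_mult_self [simp]: "cl_sign A B * cl_sign A B = 1"
  by (simp add: cl_sign_def flip: power_mult_distrib)

text \<open>The product and action formula \<open>(\<Sum>\<^sub>A x\<^sub>A e\<^sub>A) (\<Sum>\<^sub>B y\<^sub>B e\<^sub>B) = \<Sum>\<^bsub>A,B\<^esub> (x\<^sub>A \<bullet> y\<^sub>B) e\<^sub>A e\<^sub>B\<close>, for an
  arbitrary product \<open>\<bullet>\<close> of the coefficients.\<close>

definition cl_conv :: "('a \<Rightarrow> 'b \<Rightarrow> 'c::real_vector) \<Rightarrow> ('n::{finite,linorder} set \<Rightarrow> 'a)
    \<Rightarrow> ('n set \<Rightarrow> 'b) \<Rightarrow> 'n set \<Rightarrow> 'c" where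
  "cl_conv m x y C =
     (\<Sum>A\<in>UNIV. \<Sum>B\<in>UNIV. if sym_diff A B = C then cl_sign A B *\<^sub>R m (x A) (y B) else 0)"

lemma sym_diff_eq_iff: "sym_diff A B = C \<longleftrightarrow> B = sym_diff A C"
  by blast

lemma cl_conv_alt:
  "cl_conv m x y C = (\<Sum>A\<in>UNIV. cl_sign A (sym_diff A C) *\<^sub>R m (x A) (y (sym_diff A C)))"
  unfolding cl_conv_def sym_diff_eq_iff by simp

lemma cl_conv_assoc:
  fixes m1 :: "'a::real_normed_vector \<Rightarrow> 'b::real_normed_vector \<Rightarrow> 'ab::real_normed_vector"
    and m2 :: "'ab \<Rightarrow> 'c::real_normed_vector \<Rightarrow> 'd::real_normed_vector"
    and m3 :: "'b \<Rightarrow> 'c \<Rightarrow> 'bc::real_normed_vector" and m4 :: "'a \<Rightarrow> 'bc \<Rightarrow> 'd"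
    and x :: "'n::{finite,linorder} set \<Rightarrow> 'a"
  assumes "bounded_bilinear m2" "bounded_bilinear m4"
    and ass: "\<And>a b c. m2 (m1 a b) c = m4 a (m3 b c)"
  shows "cl_conv m2 (cl_conv m1 x y) z D = cl_conv m4 x (cl_conv m3 y z) D"
proof -
  interpret m2: bounded_bilinear m2 by fact
  interpret m4: bounded_bilinear m4 by fact
  have L: "cl_conv m2 (cl_conv m1 x y) z D =
    (\<Sum>A\<in>UNIV. \<Sum>E\<in>UNIV. (cl_sign E (sym_diff E D) * cl_sign A (sym_diff A E)) *\<^sub>R
        m4 (x A) (m3 (y (sym_diff A E)) (z (sym_diff E D))))"
    unfolding cl_conv_alt
    by (subst sum.swap)
       (simp add: m2.sum_left m2.scaleR_left scaleR_sum_right ass)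
  have R: "cl_conv m4 x (cl_conv m3 y z) D =
    (\<Sum>A\<in>UNIV. \<Sum>B\<in>UNIV. (cl_sign A (sym_diff A D) * cl_sign B (sym_diff B (sym_diff A D))) *\<^sub>R
        m4 (x A) (m3 (y B) (z (sym_diff B (sym_diff A D)))))"
    unfolding cl_conv_alt
    by (simp add: m4.sum_right m4.scaleR_right scaleR_sum_right)
  have "(\<Sum>B\<in>UNIV. (cl_sign A (sym_diff A D) * cl_sign B (sym_diff B (sym_diff A D))) *\<^sub>R
        m4 (x A) (m3 (y B) (z (sym_diff B (sym_diff A D))))) =
     (\<Sum>E\<in>UNIV. (cl_sign E (sym_diff E D) * cl_sign A (sym_diff A E)) *\<^sub>R
        m4 (x A) (m3 (y (sym_diff A E)) (z (sym_diff E D))))" for A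
  proof -
    have bij: "bij_betw (\<lambda>E. sym_diff A E) UNIV UNIV"
      by (rule bij_betw_byWitness[where f' = "\<lambda>E. sym_diff A E"]) auto
    have e: "sym_diff (sym_diff A E) (sym_diff A D) = sym_diff E D" for E
      by blast
    have "cl_sign A (sym_diff A D) * cl_sign (sym_diff A E) (sym_diff E D) =
        cl_sign E (sym_diff E D) * cl_sign A (sym_diff A E)" for E
      unfolding cl_sign_sym_diff_left cl_sign_sym_diff_right
      using cl_sign_mult_self[of A D] by algebra
    then show ?thesis
      by (subst sum.reindex_bij_betw[OF bij, symmetric]) (simp only: e)
  qed
  then show ?thesis
    unfolding L R by simp
qed

instantiation clifford :: ("{real_normed_algebra, monoid_mult}", "{finite, linorder}")
  "{real_normed_algebra, monoid_mult}"
begin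

definition one_clifford :: "('a, 'b) clifford" where
  "one_clifford = cmonom {} 1"

lift_definition times_clifford :: "('a, 'b) clifford \<Rightarrow> ('a, 'b) clifford \<Rightarrow> ('a, 'b) clifford"
  is "cl_conv (*)" .

instance
proof
  fix x y z :: "('a, 'b) clifford" and r :: real
  show "x * y * z = x * (y * z)"
    by (rule clifford_eqI)
       (simp add: times_clifford.rep_eq cl_conv_assoc bounded_bilinear_mult mult.assoc)
  show "(x + y) * z = x * z + y * z" "x * (y + z) = x * y + x * z"
    by (rule clifford_eqI, simp add: times_clifford.rep_eq plus_clifford.rep_eq cl_conv_alt
        algebra_simps sum.distrib)+
  show "r *\<^sub>R x * y = r *\<^sub>R (x * y)" "x * r *\<^sub>R y = r *\<^sub>R (x * y)"
    by (rule clifford_eqI, simp add: times_clifford.rep_eq scaleR_clifford.rep_eq cl_conv_alt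
        scaleR_sum_right mult.commute)+
  show "1 * x = x"
    by (rule clifford_eqI)
       (simp add: times_clifford.rep_eq one_clifford_def ccoeff_cmonom cl_conv_alt
          if_distrib[of "\<lambda>t. t * _"] if_distrib[of "\<lambda>t. _ *\<^sub>R t"] cong: if_cong)
  show "x * 1 = x"
  proof (rule clifford_eqI)
    fix C :: "'b set"
    have "sym_diff A C = {} \<longleftrightarrow> A = C" for A by auto
    then show "ccoeff (x * 1) C = ccoeff x C"
      by (simp add: times_clifford.rep_eq one_clifford_def ccoeff_cmonom cl_conv_alt
          if_distrib[of "\<lambda>t. _ * t"] if_distrib[of "\<lambda>t. _ *\<^sub>R t"] cong: if_cong)
  qed
  show "norm (x * y) \<le> norm x * norm y"
  proof -
    have *: "(\<Sum>C\<in>UNIV. norm (ccoeff y (sym_diff A C))) = norm y" for A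
    proof -
      have bij: "bij_betw (\<lambda>E. sym_diff A E) UNIV UNIV"
        by (rule bij_betw_byWitness[where f' = "\<lambda>E. sym_diff A E"]) auto
      show ?thesis
        unfolding norm_clifford.rep_eq
        by (rule sum.reindex_bij_betw[OF bij, of "\<lambda>B. norm (ccoeff y B)"])
    qed
    have "norm (x * y) \<le> (\<Sum>C\<in>UNIV. \<Sum>A\<in>UNIV. norm (ccoeff x A) * norm (ccoeff y (sym_diff A C)))"
      unfolding norm_clifford.rep_eq times_clifford.rep_eq cl_conv_alt
      by (intro sum_mono order.trans[OF norm_sum]) (simp add: norm_mult_ineq)
    also have "\<dots> = (\<Sum>A\<in>UNIV. norm (ccoeff x A) * (\<Sum>C\<in>UNIV. norm (ccoeff y (sym_diff A C))))"
      by (subst sum.swap) (simp add: sum_distrib_left)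
    also have "\<dots> = norm x * norm y"
      unfolding * by (simp add: norm_clifford.rep_eq sum_distrib_right)
    finally show ?thesis .
  qed
qed

end

lemma cmonom_mult:
  fixes a b :: "'a::{real_normed_algebra, monoid_mult}"
  shows "cmonom A a * cmonom B b = cmonom (sym_diff A B) (cl_sign A B *\<^sub>R (a * b))"
proof (rule clifford_eqI)
  fix C
  have "sym_diff A C = B \<longleftrightarrow> C = sym_diff A B" by blast
  then show "ccoeff (cmonom A a * cmonom B b) C =
      ccoeff (cmonom (sym_diff A B) (cl_sign A B *\<^sub>R (a * b))) C"
    by (auto simp: times_clifford.rep_eq ccoeff_cmonom cl_conv_alt if_distrib[of "\<lambda>t. t * _"]
        if_distrib[of "\<lambda>t. _ *\<^sub>R t"] cong: if_cong)
qed

definition cgen :: "'n::{finite,linorder} \<Rightarrow> 'n cl" where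
  "cgen i = cmonom {i} 1"

lemma cgen_square: "cgen i * cgen i = - 1"
  by (rule clifford_eqI)
     (simp add: cgen_def cmonom_mult one_clifford_def ccoeff_cmonom uminus_clifford.rep_eq
        cl_sign_def conj_commute cong: conj_cong)

lemma cgen_anticommute:
  assumes "i \<noteq> j"
  shows "cgen i * cgen j + cgen j * cgen i = 0"
proof -
  have 1: "{(a, b). a = k \<and> b = l \<and> b \<le> a} = (if l \<le> k then {(k, l)} else {})" for k l :: 'a
    by auto
  show ?thesis
    using assms
    by (intro clifford_eqI, cases "i \<le> j")
       (auto simp: cgen_def cmonom_mult ccoeff_cmonom plus_clifford.rep_eq zero_clifford.rep_eq
         cl_sign_def 1)
qed

lemma cmonom_insert_greater:
  assumes "\<And>a. a \<in> A \<Longrightarrow> a < i"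
  shows "(cmonom (insert i A) 1 :: 'n::{finite,linorder} cl) = cmonom A 1 * cgen i"
proof -
  have "{(a, b). a \<in> A \<and> b = i \<and> b \<le> a} = {}"
    using assms by force
  then have "cl_sign A {i} = 1"
    unfolding cl_sign_def singleton_iff by (simp only: card.empty power_0)
  moreover have "sym_diff A {i} = insert i A"
    using assms by blast
  ultimately show ?thesis
    by (simp add: cgen_def cmonom_mult)
qed


section \<open>Paravectors and axially symmetric sets\<close>

type_synonym 'n para = "real \<times> (real ^ 'n)"

definition cpara :: "'n::{finite,linorder} para \<Rightarrow> 'n cl" where
  "cpara x = fst x *\<^sub>R 1 + (\<Sum>l\<in>UNIV. (snd x $ l) *\<^sub>R cgen l)"

definition pconj :: "'n::finite para \<Rightarrow> 'n para" where
  "pconj x = (fst x, - snd x)"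

definition imag_sphere :: "(real ^ 'n::finite) set" where
  "imag_sphere = {j. (\<Sum>l\<in>UNIV. (j $ l)\<^sup>2) = 1}"

abbreviation imag_unit :: "real ^ 'n::{finite,linorder} \<Rightarrow> 'n cl" where
  "imag_unit j \<equiv> cpara (0, j)"

text \<open>\<open>slice j (u + \<i>v)\<close> is the point \<open>u + jv\<close>; it identifies the complex numbers with \<open>\<complex>\<^sub>j\<close>.
  Functions of the pair \<open>(u, v)\<close> are written as functions of \<open>u + \<i>v\<close>.\<close>

definition slice :: "real ^ 'n::finite \<Rightarrow> complex \<Rightarrow> 'n para" where
  "slice j z = (Re z, Im z *\<^sub>R j)"

definition axially_symmetric :: "'n::finite para set \<Rightarrow> bool" where
  "axially_symmetric U \<longleftrightarrow> (\<forall>x\<in>U. \<forall>j\<in>imag_sphere. (fst x, norm (snd x) *\<^sub>R j) \<in> U)"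

definition plane_set :: "'n::finite para set \<Rightarrow> complex set" where
  "plane_set U = {z. \<forall>j\<in>imag_sphere. slice j z \<in> U}"


section \<open>Poly slice monogenic functions\<close>

definition d_u :: "(complex \<Rightarrow> 'a::real_normed_vector) \<Rightarrow> complex \<Rightarrow> 'a" where
  "d_u G z = vector_derivative (\<lambda>t. G (Complex t (Im z))) (at (Re z))"

definition d_v :: "(complex \<Rightarrow> 'a::real_normed_vector) \<Rightarrow> complex \<Rightarrow> 'a" where
  "d_v G z = vector_derivative (\<lambda>t. G (Complex (Re z) t)) (at (Im z))"

text \<open>Class \<open>C\<^sup>k\<close> on an open set of the \<open>(u,v)\<close>-plane.\<close>

primrec Ck_on :: "nat \<Rightarrow> complex set \<Rightarrow> (complex \<Rightarrow> 'a::real_normed_vector) \<Rightarrow> bool" where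
  "Ck_on 0 S G \<longleftrightarrow> continuous_on S G"
| "Ck_on (Suc k) S G \<longleftrightarrow>
     (\<forall>z\<in>S. (\<lambda>t. G (Complex t (Im z))) differentiable (at (Re z)) \<and>
            (\<lambda>t. G (Complex (Re z) t)) differentiable (at (Im z))) \<and>
     Ck_on k S (d_u G) \<and> Ck_on k S (d_v G)"

definition dbar_L :: "real ^ 'n::{finite,linorder} \<Rightarrow> (complex \<Rightarrow> 'n cl) \<Rightarrow> complex \<Rightarrow> 'n cl" where
  "dbar_L j G z = (1/2) *\<^sub>R (d_u G z + imag_unit j * d_v G z)"

definition dbar_R :: "real ^ 'n::{finite,linorder} \<Rightarrow> (complex \<Rightarrow> 'n cl) \<Rightarrow> complex \<Rightarrow> 'n cl" where
  "dbar_R j G z = (1/2) *\<^sub>R (d_u G z + d_v G z * imag_unit j)"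

definition poly_slice_monogenic_L ::
  "nat \<Rightarrow> 'n::{finite,linorder} para set \<Rightarrow> ('n para \<Rightarrow> 'n cl) \<Rightarrow> bool" where
  "poly_slice_monogenic_L M U F \<longleftrightarrow> open U \<and> axially_symmetric U \<and>
     (\<exists>F0 F1. Ck_on M (plane_set U) F0 \<and> Ck_on M (plane_set U) F1 \<and>
        (\<forall>z\<in>plane_set U. F0 (cnj z) = F0 z \<and> F1 (cnj z) = - F1 z) \<and>
        (\<forall>j\<in>imag_sphere. \<forall>z\<in>plane_set U.
           F (slice j z) = F0 z + imag_unit j * F1 z \<and>
           (dbar_L j ^^ M) (\<lambda>w. F0 w + imag_unit j * F1 w) z = 0))"

definition poly_slice_monogenic_R ::
  "nat \<Rightarrow> 'n::{finite,linorder} para set \<Rightarrow> ('n para \<Rightarrow> 'n cl) \<Rightarrow> bool" where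
  "poly_slice_monogenic_R M U F \<longleftrightarrow> open U \<and> axially_symmetric U \<and>
     (\<exists>F0 F1. Ck_on M (plane_set U) F0 \<and> Ck_on M (plane_set U) F1 \<and>
        (\<forall>z\<in>plane_set U. F0 (cnj z) = F0 z \<and> F1 (cnj z) = - F1 z) \<and>
        (\<forall>j\<in>imag_sphere. \<forall>z\<in>plane_set U.
           F (slice j z) = F0 z + F1 z * imag_unit j \<and>
           (dbar_R j ^^ M) (\<lambda>w. F0 w + F1 w * imag_unit j) z = 0))"

abbreviation slice_monogenic_L ::
  "'n::{finite,linorder} para set \<Rightarrow> ('n para \<Rightarrow> 'n cl) \<Rightarrow> bool" where
  "slice_monogenic_L \<equiv> poly_slice_monogenic_L 1"

abbreviation slice_monogenic_R ::
  "'n::{finite,linorder} para set \<Rightarrow> ('n para \<Rightarrow> 'n cl) \<Rightarrow> bool" where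
  "slice_monogenic_R \<equiv> poly_slice_monogenic_R 1"

text \<open>\<open>f 0, \<dots>, f (M - 1)\<close> are the components of \<open>F\<close>.\<close>

definition components_L :: "nat \<Rightarrow> 'n::{finite,linorder} para set \<Rightarrow> ('n para \<Rightarrow> 'n cl)
    \<Rightarrow> (nat \<Rightarrow> 'n para \<Rightarrow> 'n cl) \<Rightarrow> bool" where
  "components_L M U F f \<longleftrightarrow> (\<forall>k<M. slice_monogenic_L U (f k)) \<and>
     (\<forall>x\<in>U. F x = (\<Sum>k<M. cpara (pconj x) ^ k * f k x))"

definition components_R :: "nat \<Rightarrow> 'n::{finite,linorder} para set \<Rightarrow> ('n para \<Rightarrow> 'n cl)
    \<Rightarrow> (nat \<Rightarrow> 'n para \<Rightarrow> 'n cl) \<Rightarrow> bool" where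
  "components_R M U F f \<longleftrightarrow> (\<forall>k<M. slice_monogenic_R U (f k)) \<and>
     (\<forall>x\<in>U. F x = (\<Sum>k<M. f k x * cpara (pconj x) ^ k))"


section \<open>Slice Cauchy domains and integration over their boundary\<close>

text \<open>
  \<open>\<Gamma>\<close> is a set of parametrizations of the boundary curves of \<open>D\<close>. Positive orientation (\<open>D\<close> lies to
  the left of its boundary) is expressed by the total winding number, which has to jump up by one on
  entering \<open>D\<close>. The constant \<open>c\<close> is \<open>0\<close> for bounded \<open>D\<close>.
\<close>

definition oriented_boundary :: "complex set \<Rightarrow> (real \<Rightarrow> complex) set \<Rightarrow> bool" where
  "oriented_boundary D \<Gamma> \<longleftrightarrow> finite \<Gamma> \<and>
     (\<forall>\<gamma>\<in>\<Gamma>. valid_path \<gamma> \<and> simple_path \<gamma> \<and> pathfinish \<gamma> = pathstart \<gamma>) \<and>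
     disjoint_family_on path_image \<Gamma> \<and>
     (\<Union>\<gamma>\<in>\<Gamma>. path_image \<gamma>) = frontier D \<and>
     (\<exists>c. (\<forall>z\<in>D. (\<Sum>\<gamma>\<in>\<Gamma>. winding_number \<gamma> z) = c + 1) \<and>
          (\<forall>z. z \<notin> closure D \<longrightarrow> (\<Sum>\<gamma>\<in>\<Gamma>. winding_number \<gamma> z) = c))"

definition slice_Cauchy_domain :: "'n::finite para set \<Rightarrow> bool" where
  "slice_Cauchy_domain U \<longleftrightarrow> open U \<and> axially_symmetric U \<and>
     (\<forall>j\<in>imag_sphere. \<exists>\<Gamma>. oriented_boundary (slice j -` U) \<Gamma>)"

text \<open>The integral over \<open>\<Gamma>\<close>, as a subset of \<open>\<complex>\<^sub>j\<close>, of a form \<open>H s ds\<^sub>j\<close> that is linear in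
  \<open>ds\<^sub>j = ds (-j)\<close>. The point \<open>s = slice j z\<close> is passed to \<open>H\<close> as the complex number \<open>z\<close>.\<close>

definition slice_integral :: "real ^ 'n::{finite,linorder} \<Rightarrow> (real \<Rightarrow> complex) set
    \<Rightarrow> (complex \<Rightarrow> 'n cl \<Rightarrow> 'b::real_normed_vector) \<Rightarrow> 'b" where
  "slice_integral j \<Gamma> H = (\<Sum>\<gamma>\<in>\<Gamma>. integral {0..1} (\<lambda>t.
     H (\<gamma> t) (cpara (slice j (vector_derivative \<gamma> (at t within {0..1}))) * (- imag_unit j))))"


section \<open>Clifford operators\<close>

text \<open>The action of \<open>T = \<Sum>\<^sub>A e\<^sub>A T\<^sub>A\<close> on \<open>V\<^sub>n\<close>, and the left action of \<open>\<real>\<^sub>n\<close> on \<open>V\<^sub>n\<close>. The norm of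
  \<open>'v ^ 'n set\<close> is the Euclidean norm of the norms of the components.\<close>

definition clop_apply :: "('v::real_normed_vector, 'n::{finite,linorder}) clop
    \<Rightarrow> 'v ^ 'n set \<Rightarrow> 'v ^ 'n set" where
  "clop_apply T v = (\<chi> C. cl_conv (\<lambda>S. blinfun_apply (blinfun_of_endo S)) (ccoeff T) (($) v) C)"

definition cl_smult :: "'n::{finite,linorder} cl \<Rightarrow> ('v::real_normed_vector) ^ 'n set
    \<Rightarrow> 'v ^ 'n set" where
  "cl_smult a v = (\<chi> C. cl_conv scaleR (ccoeff a) (($) v) C)"

text \<open>The operator \<open>a \<I>\<close>, so that the operators \<open>aT\<close> and \<open>Ta\<close> are the products with it.\<close>

definition clop_of :: "'n::{finite,linorder} cl \<Rightarrow> ('v::real_normed_vector, 'n) clop" where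
  "clop_of a = Clifford (\<lambda>A. ccoeff a A *\<^sub>R 1)"

lemma bounded_bilinear_endo_apply:
  "bounded_bilinear (\<lambda>S. blinfun_apply (blinfun_of_endo S))"
proof
  show "\<exists>K. \<forall>a b. norm (blinfun_apply (blinfun_of_endo a) b) \<le> norm a * norm b * K"
    by (rule exI[of _ 1]) (simp add: norm_endo.rep_eq norm_blinfun)
qed (simp_all add: plus_endo.rep_eq scaleR_endo.rep_eq blinfun.bilinear_simps)

lemma clop_apply_mult: "clop_apply (S * T) v = clop_apply S (clop_apply T v)"
proof -
  let ?m = "\<lambda>S. blinfun_apply (blinfun_of_endo S)"
  have e: "($) (clop_apply R u) = cl_conv ?m (ccoeff R) (($) u)" for R :: "('a, 'b) clop" and u
    by (simp add: fun_eq_iff clop_apply_def)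
  have "cl_conv ?m (cl_conv (*) (ccoeff S) (ccoeff T)) (($) v) C =
      cl_conv ?m (ccoeff S) (cl_conv ?m (ccoeff T) (($) v)) C" for C
    by (rule cl_conv_assoc) (simp_all add: bounded_bilinear_endo_apply times_endo.rep_eq)
  then show ?thesis
    by (simp add: vec_eq_iff e times_clifford.rep_eq)
qed

lemma clop_apply_clop_of: "clop_apply (clop_of a) v = cl_smult a v"
  by (simp add: vec_eq_iff clop_apply_def cl_smult_def clop_of_def Clifford_inverse cl_conv_alt
      scaleR_endo.rep_eq one_endo.rep_eq blinfun.bilinear_simps)

lemma clop_apply_one:
  fixes v :: "('v::real_normed_vector) ^ 'n::{finite,linorder} set"
  shows "clop_apply 1 v = v"
proof -
  have "clop_apply 1 v $ C = v $ C" for C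
  proof -
    have "clop_apply 1 v $ C = (\<Sum>A\<in>UNIV. cl_sign A (sym_diff A C) *\<^sub>R
        blinfun_of_endo (if A = {} then 1 else 0) (v $ sym_diff A C))"
      by (simp only: clop_apply_def vec_lambda_beta one_clifford_def ccoeff_cmonom cl_conv_alt)
    also have "\<dots> = (\<Sum>A\<in>(UNIV :: 'n set set). if A = {} then v $ C else 0)"
      by (rule sum.cong[OF refl]) (auto simp: zero_endo.rep_eq one_endo.rep_eq)
    finally show ?thesis
      by simp
  qed
  then show ?thesis
    by (simp add: vec_eq_iff)
qed

lemma clop_apply_smult_left: "clop_apply (clop_of a * T) v = cl_smult a (clop_apply T v)"
  by (simp add: clop_apply_mult clop_apply_clop_of)

lemma clop_apply_smult_right: "clop_apply (T * clop_of a) v = clop_apply T (cl_smult a v)"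
  by (simp add: clop_apply_mult clop_apply_clop_of)

lemma clop_apply_inject:
  fixes S T :: "('v::real_normed_vector, 'n::{finite,linorder}) clop"
  assumes "\<And>v. clop_apply S v = clop_apply T v"
  shows "S = T"
proof (intro clifford_eqI endo_eqI blinfun_eqI)
  fix A :: "'n set" and w :: 'v
  have "clop_apply R (\<chi> B. if B = {} then w else 0) $ A = blinfun_of_endo (ccoeff R A) w"
    for R :: "('v, 'n) clop"
  proof -
    have "clop_apply R (\<chi> B. if B = {} then w else 0) $ A = (\<Sum>B\<in>UNIV. cl_sign B (sym_diff B A) *\<^sub>R
        blinfun_of_endo (ccoeff R B) (if sym_diff B A = {} then w else 0))"
      by (simp only: clop_apply_def vec_lambda_beta cl_conv_alt)
    also have "\<dots> = (\<Sum>B\<in>UNIV. if B = A then blinfun_of_endo (ccoeff R A) w else 0)"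
      by (rule sum.cong[OF refl]) auto
    finally show ?thesis
      by simp
  qed
  then show "blinfun_of_endo (ccoeff S A) w = blinfun_of_endo (ccoeff T A) w"
    using assms by metis
qed

definition paravector_op :: "('v::real_normed_vector, 'n::{finite,linorder}) clop \<Rightarrow> bool" where
  "paravector_op T \<longleftrightarrow> (\<exists>T0 T1. T = cmonom {} T0 + (\<Sum>l\<in>UNIV. cmonom {l} (T1 l)))"

definition op_conj :: "('v::real_normed_vector, 'n::{finite,linorder}) clop \<Rightarrow> ('v, 'n) clop" where
  "op_conj T = cmonom {} (ccoeff T {}) - (\<Sum>l\<in>UNIV. cmonom {l} (ccoeff T {l}))"

lemma op_conj_paravector:
  "op_conj (cmonom {} T0 + (\<Sum>l\<in>UNIV. cmonom {l} (T1 l))) =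
     cmonom {} T0 - (\<Sum>l\<in>UNIV. cmonom {l} (T1 l))"
  by (simp add: op_conj_def plus_clifford.rep_eq ccoeff_sum ccoeff_cmonom)

definition unit_elem :: "'a::monoid_mult \<Rightarrow> bool" where
  "unit_elem x \<longleftrightarrow> (\<exists>y. x * y = 1 \<and> y * x = 1)"

definition unit_inv :: "'a::monoid_mult \<Rightarrow> 'a" where
  "unit_inv x = (THE y. x * y = 1 \<and> y * x = 1)"

definition Qs :: "'n::{finite,linorder} para \<Rightarrow> ('v::real_normed_vector, 'n) clop \<Rightarrow> ('v, 'n) clop" where
  "Qs s T = T ^ 2 - (2 * fst s) *\<^sub>R T + (norm s)\<^sup>2 *\<^sub>R 1"

definition S_resolvent :: "('v::real_normed_vector, 'n::{finite,linorder}) clop \<Rightarrow> 'n para set" where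
  "S_resolvent T = {s. unit_elem (Qs s T)}"

definition S_spectrum :: "('v::real_normed_vector, 'n::{finite,linorder}) clop \<Rightarrow> 'n para set" where
  "S_spectrum T = - S_resolvent T"

definition S_L :: "'n::{finite,linorder} para \<Rightarrow> ('v::real_normed_vector, 'n) clop \<Rightarrow> ('v, 'n) clop" where
  "S_L s T = - (unit_inv (Qs s T) * (T - clop_of (cpara (pconj s))))"

definition S_R :: "'n::{finite,linorder} para \<Rightarrow> ('v::real_normed_vector, 'n) clop \<Rightarrow> ('v, 'n) clop" where
  "S_R s T = - ((T - clop_of (cpara (pconj s))) * unit_inv (Qs s T))"

definition Pi_S_L ::
  "nat \<Rightarrow> 'n::{finite,linorder} para \<Rightarrow> ('v::real_normed_vector, 'n) clop \<Rightarrow> ('v, 'n) clop" where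
  "Pi_S_L l s T = (1 / fact l) *\<^sub>R (\<Sum>k\<le>l. real (l choose k) *\<^sub>R
     (op_conj T ^ k * S_L s T * clop_of ((- cpara (pconj s)) ^ (l - k))))"

definition Pi_S_R ::
  "nat \<Rightarrow> 'n::{finite,linorder} para \<Rightarrow> ('v::real_normed_vector, 'n) clop \<Rightarrow> ('v, 'n) clop" where
  "Pi_S_R l s T = (1 / fact l) *\<^sub>R (\<Sum>k\<le>l. real (l choose k) *\<^sub>R
     (clop_of ((- cpara (pconj s)) ^ (l - k)) * S_R s T * op_conj T ^ k))"

text \<open>\<open>U\<close> is an admissible domain of integration for functions on \<open>D\<close> and the set \<open>K\<close>.\<close>

definition admissible :: "'n::finite para set \<Rightarrow> 'n para set \<Rightarrow> 'n para set \<Rightarrow> bool" where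
  "admissible K D U \<longleftrightarrow> bounded U \<and> slice_Cauchy_domain U \<and> K \<subseteq> U \<and> closure U \<subseteq> D"

text \<open>The classes \<open>\<P>\<S>\<^sup>M\<^sub>L(K)\<close> and \<open>\<P>\<S>\<^sup>M\<^sub>R(K)\<close>; a function is given together with its domain.\<close>

definition PS_L :: "nat \<Rightarrow> 'n::{finite,linorder} para set
    \<Rightarrow> ('n para set \<times> ('n para \<Rightarrow> 'n cl)) set" where
  "PS_L M K = {(D, F). poly_slice_monogenic_L M D F \<and> (\<exists>U. admissible K D U)}"

definition PS_R :: "nat \<Rightarrow> 'n::{finite,linorder} para set
    \<Rightarrow> ('n para set \<times> ('n para \<Rightarrow> 'n cl)) set" where
  "PS_R M K = {(D, F). poly_slice_monogenic_R M D F \<and> (\<exists>U. admissible K D U)}"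

end

theory Submission
  imports Defs
begin

text \<open>
  The two integrals agree because their integrands agree at every point of the boundary. Write
  \<open>\<sigma>\<close> for the conjugate of \<open>s\<close>. On \<open>\<complex>\<^sub>j\<close> the Cauchy-Riemann operator \<open>1/2 (\<partial>\<^sub>u + j \<partial>\<^sub>v)\<close> annihilates
  the components \<open>f\<^sub>k\<close> and maps \<open>\<sigma>\<close> to \<open>1\<close>. Since \<open>\<sigma>\<close> commutes with \<open>j\<close>, the operator therefore
  differentiates \<open>F = \<Sum>\<^sub>k \<sigma>\<^sup>k f\<^sub>k\<close> like a polynomial in \<open>\<sigma>\<close> with constant coefficients
  (\<open>dbar_power_polynomial\<close>).

  The kernel \<open>\<Pi>\<^sub>l S\<^sup>-\<^sup>1\<close> is the Taylor weight \<open>(\<tau> - \<sigma>)\<^sup>l / l!\<close> with \<open>\<tau>\<close> the conjugate of \<open>T\<close>, expanded by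
  the binomial theorem, with the powers of \<open>\<tau>\<close> and of \<open>\<sigma>\<close> on opposite sides of the resolvent. Pairing
  it with the derivatives of \<open>F\<close> re-expands the polynomial at \<open>\<tau>\<close>, which replaces \<open>\<sigma>\<^sup>k\<close> by \<open>\<tau>\<^sup>k\<close>.
  The form \<open>ds\<^sub>j\<close> stands between the powers of \<open>\<sigma>\<close> from the kernel and those from \<open>F\<close>, but it has
  values in the commutative plane \<open>\<complex>\<^sub>j\<close>, so these powers can be collected. The terms that remain
  cancel by the orthogonality of the matrices \<open>(k choose l)\<close> and \<open>(-1)\<^sup>l\<^sup>-\<^sup>m (l choose m)\<close>
  (\<open>binomial_orthogonality\<close>).

  The left and the right version differ only in the side on which \<open>\<complex>\<^sub>j\<close> multiplies. Both are
  instances of one computation with an abstract multiplication that is associative on commuting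
  elements (\<open>taylor_re_expansion\<close>).
\<close>

section \<open>Orthogonality of binomial coefficients\<close>

lemma binomial_orthogonality:
  assumes "k < M"
  shows "(\<Sum>l<M. real (k choose l) * real (l choose m) * (-1) ^ (l - m)) = (if k = m then 1 else 0)"
proof (cases "m \<le> k")
  case True
  have "(\<Sum>l<M. real (k choose l) * real (l choose m) * (-1) ^ (l - m)) =
      (\<Sum>l\<in>{m..k}. real (k choose l) * real (l choose m) * (-1) ^ (l - m))"
    using assms by (intro sum.mono_neutral_right) (auto simp: not_le)
  also have "\<dots> = (\<Sum>l\<in>{m..k}. real (k choose m) * ((-1) ^ (l - m) * real (k - m choose (l - m))))"
    by (rule sum.cong) (simp_all add: choose_mult flip: of_nat_mult)
  also have "\<dots> = real (k choose m) * (\<Sum>i\<le>k - m. (-1) ^ i * real (k - m choose i))"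
    unfolding sum_distrib_left
    by (rule sum.reindex_bij_witness[of _ "\<lambda>i. m + i" "\<lambda>l. l - m"]) (use True in auto)
  also have "\<dots> = (if k = m then 1 else 0)"
    using True choose_alternating_sum[of "k - m", where 'a = real] by auto
  finally show ?thesis .
next
  case False
  have "(\<Sum>l<M. real (k choose l) * real (l choose m) * (-1) ^ (l - m)) = 0"
    by (intro sum.neutral) (use False in auto)
  then show ?thesis
    using False by simp
qed

text \<open>The combinatorial form of the re-expansion of a polynomial by its Taylor formula: \<open>X k m\<close>
  is the contribution of the monomial of degree \<open>k\<close> in which \<open>m\<close> of the factors have been replaced
  by the new variable.\<close>

lemma taylor_sum_diagonal:
  fixes X :: "nat \<Rightarrow> nat \<Rightarrow> 'a::real_vector"
  shows "(\<Sum>l<M. (1 / fact l) *\<^sub>R (\<Sum>m\<le>l. real (l choose m) *\<^sub>R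
      (\<Sum>k\<in>{l..<M}. ((-1) ^ (l - m) * (fact k / fact (k - l))) *\<^sub>R X k m))) = (\<Sum>k<M. X k k)"
    (is "?lhs = _")
proof -
  let ?c = "\<lambda>l m k. real (k choose l) * real (l choose m) * (-1) ^ (l - m)"
  have "(1 / fact l) *\<^sub>R (\<Sum>m\<le>l. real (l choose m) *\<^sub>R
      (\<Sum>k\<in>{l..<M}. ((-1) ^ (l - m) * (fact k / fact (k - l))) *\<^sub>R X k m)) =
      (\<Sum>k<M. \<Sum>m<M. ?c l m k *\<^sub>R X k m)" if "l < M" for l
  proof -
    have "(1 / fact l) *\<^sub>R (\<Sum>m\<le>l. real (l choose m) *\<^sub>R
        (\<Sum>k\<in>{l..<M}. ((-1) ^ (l - m) * (fact k / fact (k - l))) *\<^sub>R X k m)) =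
        (\<Sum>m\<le>l. \<Sum>k\<in>{l..<M}. ?c l m k *\<^sub>R X k m)"
      unfolding scaleR_sum_right by (intro sum.cong refl) (simp add: binomial_fact mult_ac)
    also have "\<dots> = (\<Sum>m\<le>l. \<Sum>k<M. ?c l m k *\<^sub>R X k m)"
      by (intro sum.cong refl sum.mono_neutral_left) auto
    also have "\<dots> = (\<Sum>m<M. \<Sum>k<M. ?c l m k *\<^sub>R X k m)"
      using that by (intro sum.mono_neutral_left) (auto intro!: sum.neutral)
    also have "\<dots> = (\<Sum>k<M. \<Sum>m<M. ?c l m k *\<^sub>R X k m)"
      by (rule sum.swap)
    finally show ?thesis .
  qed
  then have "?lhs = (\<Sum>l<M. \<Sum>k<M. \<Sum>m<M. ?c l m k *\<^sub>R X k m)"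
    by (intro sum.cong) auto
  also have "\<dots> = (\<Sum>k<M. \<Sum>l<M. \<Sum>m<M. ?c l m k *\<^sub>R X k m)"
    by (rule sum.swap)
  also have "\<dots> = (\<Sum>k<M. \<Sum>m<M. (\<Sum>l<M. ?c l m k) *\<^sub>R X k m)"
    unfolding scaleR_sum_left by (rule sum.cong[OF refl]) (rule sum.swap)
  also have "\<dots> = (\<Sum>k<M. \<Sum>m<M. if k = m then X k m else 0)"
    by (intro sum.cong refl) (simp add: binomial_orthogonality)
  finally show ?thesis
    by simp
qed


section \<open>Partial derivatives in the plane\<close>

definition has_partials ::
  "(complex \<Rightarrow> 'a::real_normed_vector) \<Rightarrow> 'a \<Rightarrow> 'a \<Rightarrow> complex \<Rightarrow> bool" where
  "has_partials G Gu Gv z \<longleftrightarrow>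
     ((\<lambda>t. G (Complex t (Im z))) has_vector_derivative Gu) (at (Re z)) \<and>
     ((\<lambda>t. G (Complex (Re z) t)) has_vector_derivative Gv) (at (Im z))"

lemma has_partials_imp_d_u: "has_partials G Gu Gv z \<Longrightarrow> d_u G z = Gu"
  and has_partials_imp_d_v: "has_partials G Gu Gv z \<Longrightarrow> d_v G z = Gv"
  by (auto simp: has_partials_def d_u_def d_v_def vector_derivative_at)

lemma has_partials_transform_open:
  assumes G: "has_partials G Gu Gv z" and W: "open W" "z \<in> W" "\<And>w. w \<in> W \<Longrightarrow> G w = H w"
  shows "has_partials H Gu Gv z"
proof -
  have "open ((\<lambda>t. Complex t (Im z)) -` W)" "open ((\<lambda>t. Complex (Re z) t) -` W)"
    by (intro open_vimage W(1) continuous_intros)+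
  moreover have "Re z \<in> (\<lambda>t. Complex t (Im z)) -` W" "Im z \<in> (\<lambda>t. Complex (Re z) t) -` W"
    using W(2) by auto
  ultimately show ?thesis
    using G W(3) unfolding has_partials_def
    by (auto intro: has_vector_derivative_transform_within_open)
qed

lemma has_partials_sum:
  assumes "\<And>i. i \<in> I \<Longrightarrow> has_partials (G i) (Gu i) (Gv i) z"
  shows "has_partials (\<lambda>w. \<Sum>i\<in>I. G i w) (\<Sum>i\<in>I. Gu i) (\<Sum>i\<in>I. Gv i) z"
  using assms unfolding has_partials_def by (auto intro!: has_vector_derivative_sum)

lemma (in bounded_linear) has_partials:
  "has_partials G Gu Gv z \<Longrightarrow> has_partials (\<lambda>w. f (G w)) (f Gu) (f Gv) z"
  unfolding has_partials_def by (auto intro: has_vector_derivative)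

lemma (in bounded_bilinear) has_partials:
  assumes "has_partials G Gu Gv z" "has_partials H Hu Hv z"
  shows "has_partials (\<lambda>w. prod (G w) (H w)) (prod (G z) Hu + prod Gu (H z))
    (prod (G z) Hv + prod Gv (H z)) z"
proof -
  have z: "Complex (Re z) (Im z) = z"
    by simp
  show ?thesis
    using assms unfolding has_partials_def
    by (auto dest: has_vector_derivative simp: z)
qed

lemma has_partials_power:
  fixes P :: "complex \<Rightarrow> 'a::{real_normed_algebra, monoid_mult}"
  assumes P: "has_partials P Pu Pv z" and c: "P z * Pu = Pu * P z" "P z * Pv = Pv * P z"
  shows "has_partials (\<lambda>w. P w ^ k) (real k *\<^sub>R (P z ^ (k - 1) * Pu)) (real k *\<^sub>R (P z ^ (k - 1) * Pv)) z"
proof (induction k)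
  case 0
  show ?case
    by (simp add: has_partials_def)
next
  case (Suc k)
  have step: "P z * (real k *\<^sub>R (P z ^ (k - 1) * D)) + D * P z ^ k =
      real (Suc k) *\<^sub>R (P z ^ (Suc k - 1) * D)" if "P z * D = D * P z" for D
    unfolding power_commuting_commutes[OF that, symmetric]
    by (cases k) (simp_all add: mult.assoc scaleR_add_left scaleR_2 distrib_left add_ac)
  show ?case
    using bounded_bilinear.has_partials[OF bounded_bilinear_mult P Suc.IH]
    by (simp only: step[OF c(1)] step[OF c(2)] power_Suc)
qed

lemma Ck_on_1_imp_has_partials:
  assumes "Ck_on 1 S G" "z \<in> S"
  shows "has_partials G (d_u G z) (d_v G z) z"
  using assms by (auto simp: has_partials_def d_u_def d_v_def simp flip: vector_derivative_works)


section \<open>Polynomials in the conjugate variable\<close>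

text \<open>
  Here \<open>J\<close> spans the complex plane \<open>\<real> + \<real> J\<close> of an algebra, and \<open>act\<close> is multiplication by its
  elements. Multiplication from the right, \<open>act a x = x * a\<close>, reverses products, so
  associativity is required for commuting factors only, which is all that occurs in this plane.
\<close>

locale plane_action = bounded_bilinear act
  for act :: "'a \<Rightarrow> 'a \<Rightarrow> 'a::{real_normed_algebra, monoid_mult}" +
  fixes J :: 'a
  assumes act_one: "act 1 x = x"
    and act_act: "a * b = b * a \<Longrightarrow> act a (act b x) = act (a * b) x"
    and J_square: "J * J = - 1"
begin

definition conj_var :: "complex \<Rightarrow> 'a" where
  "conj_var z = Re z *\<^sub>R 1 - Im z *\<^sub>R J"

definition dbar :: "(complex \<Rightarrow> 'a) \<Rightarrow> complex \<Rightarrow> 'a" where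
  "dbar G z = (1/2) *\<^sub>R (d_u G z + act J (d_v G z))"

text \<open>The witnesses make the existence of the partial derivatives part of the Cauchy-Riemann
  equation; \<open>d_u\<close> and \<open>d_v\<close> have arbitrary values where the derivatives do not exist.\<close>

definition CR_at :: "(complex \<Rightarrow> 'a) \<Rightarrow> complex \<Rightarrow> bool" where
  "CR_at g z \<longleftrightarrow> (\<exists>gu gv. has_partials g gu gv z \<and> gu + act J gv = 0)"

lemma has_partials_conj_var: "has_partials conj_var 1 (- J) z"
  unfolding has_partials_def conj_var_def by (auto intro!: derivative_eq_intros)

lemma conj_var_commutes: "conj_var z * J = J * conj_var z"
  by (simp add: conj_var_def algebra_simps)

lemma act_conj_var_powers:
  "act (conj_var z ^ m) (act (conj_var z ^ n) x) = act (conj_var z ^ (m + n)) x"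
  by (subst act_act) (simp_all add: add.commute flip: power_add)

text \<open>The partial derivatives of the conjugate variable are \<open>1\<close> and \<open>- J\<close>, and
  \<open>1 + J (- J) = 2\<close> cancels the factor \<open>1/2\<close> of \<open>dbar\<close>. The derivatives of \<open>g\<close> drop out by the
  Cauchy-Riemann equation, because \<open>J\<close> can be moved past the powers of the conjugate variable.\<close>

lemma dbar_conj_var_power_times:
  fixes k :: nat
  assumes "CR_at g z"
  defines "G \<equiv> \<lambda>w. act (conj_var w ^ k) (g w)"
  shows "has_partials G (d_u G z) (d_v G z) z"
    and "dbar G z = real k *\<^sub>R act (conj_var z ^ (k - 1)) (g z)"
proof -
  let ?p = "conj_var z"
  obtain gu gv where g: "has_partials g gu gv z" and CR: "gu + act J gv = 0"
    using assms unfolding CR_at_def by blast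
  have pow: "has_partials (\<lambda>w. conj_var w ^ k) (real k *\<^sub>R (?p ^ (k - 1) * 1))
      (real k *\<^sub>R (?p ^ (k - 1) * - J)) z"
    by (rule has_partials_power[OF has_partials_conj_var]) (simp_all add: conj_var_commutes)
  have comm: "J * ?p ^ n = ?p ^ n * J" for n
    by (rule power_commuting_commutes[symmetric]) (rule conj_var_commutes)
  have 1: "act J (act (?p ^ k) gv) = act (?p ^ k) (act J gv)"
    by (simp add: act_act comm)
  have "J * (?p ^ n * J) = - (?p ^ n)" for n
  proof -
    have "J * (?p ^ n * J) = ?p ^ n * (J * J)"
      by (metis comm mult.assoc)
    then show ?thesis
      by (simp add: J_square)
  qed
  moreover have "J * (?p ^ n * J) = (?p ^ n * J) * J" for n
    by (metis comm mult.assoc)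
  ultimately have 2: "act J (act (?p ^ n * J) x) = - act (?p ^ n) x" for n x
    by (simp add: act_act minus_left)
  have "(act (?p ^ k) gu + act (real k *\<^sub>R (?p ^ (k - 1) * 1)) (g z)) +
      act J (act (?p ^ k) gv + act (real k *\<^sub>R (?p ^ (k - 1) * - J)) (g z)) =
      act (?p ^ k) (gu + act J gv) +
      (real k *\<^sub>R act (?p ^ (k - 1)) (g z) + real k *\<^sub>R act (?p ^ (k - 1)) (g z))"
    by (simp add: add_right scaleR_left scaleR_right minus_left minus_right diff_right 1 2)
  then have "(1/2) *\<^sub>R ((act (?p ^ k) gu + act (real k *\<^sub>R (?p ^ (k - 1) * 1)) (g z)) +
      act J (act (?p ^ k) gv + act (real k *\<^sub>R (?p ^ (k - 1) * - J)) (g z))) =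
      real k *\<^sub>R act (?p ^ (k - 1)) (g z)"
    by (simp add: CR zero_right flip: scaleR_2)
  moreover have "has_partials G (act (?p ^ k) gu + act (real k *\<^sub>R (?p ^ (k - 1) * 1)) (g z))
      (act (?p ^ k) gv + act (real k *\<^sub>R (?p ^ (k - 1) * - J)) (g z)) z"
    unfolding G_def by (rule has_partials[OF pow g])
  ultimately show "has_partials G (d_u G z) (d_v G z) z"
    and "dbar G z = real k *\<^sub>R act (conj_var z ^ (k - 1)) (g z)"
    unfolding dbar_def by (simp_all only: has_partials_imp_d_u has_partials_imp_d_v)
qed

lemma dbar_polynomial:
  assumes W: "open W" "z \<in> W"
    and g: "\<And>k. k \<in> K \<Longrightarrow> CR_at (g k) z"
    and G: "\<And>w. w \<in> W \<Longrightarrow> G w = (\<Sum>k\<in>K. c k *\<^sub>R act (conj_var w ^ d k) (g k w))"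
  shows "dbar G z = (\<Sum>k\<in>K. (c k * real (d k)) *\<^sub>R act (conj_var z ^ (d k - 1)) (g k z))"
proof -
  let ?H = "\<lambda>k w. act (conj_var w ^ d k) (g k w)"
  have "has_partials (\<lambda>w. \<Sum>k\<in>K. c k *\<^sub>R ?H k w)
      (\<Sum>k\<in>K. c k *\<^sub>R d_u (?H k) z) (\<Sum>k\<in>K. c k *\<^sub>R d_v (?H k) z) z"
    by (intro has_partials_sum bounded_linear.has_partials[OF bounded_linear_scaleR_right]
        dbar_conj_var_power_times(1) g)
  then have "has_partials G (\<Sum>k\<in>K. c k *\<^sub>R d_u (?H k) z) (\<Sum>k\<in>K. c k *\<^sub>R d_v (?H k) z) z"
    by (rule has_partials_transform_open[OF _ W]) (simp add: G)
  then have "dbar G z =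
      (1/2) *\<^sub>R ((\<Sum>k\<in>K. c k *\<^sub>R d_u (?H k) z) + act J (\<Sum>k\<in>K. c k *\<^sub>R d_v (?H k) z))"
    by (simp add: dbar_def has_partials_imp_d_u has_partials_imp_d_v)
  also have "\<dots> = (\<Sum>k\<in>K. c k *\<^sub>R dbar (?H k) z)"
    by (simp add: dbar_def sum_right scaleR_right scaleR_sum_right sum.distrib scaleR_add_right)
  finally show ?thesis
    by (simp add: dbar_conj_var_power_times(2) g)
qed

lemma dbar_power_polynomial:
  assumes W: "open W"
    and g: "\<And>k z. k < M \<Longrightarrow> z \<in> W \<Longrightarrow> CR_at (g k) z"
    and G: "\<And>z. z \<in> W \<Longrightarrow> G z = (\<Sum>k<M. act (conj_var z ^ k) (g k z))"
  shows "z \<in> W \<Longrightarrow> (dbar ^^ l) G z =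
    (\<Sum>k\<in>{l..<M}. (fact k / fact (k - l)) *\<^sub>R act (conj_var z ^ (k - l)) (g k z))"
proof (induction l arbitrary: z)
  case 0
  then show ?case
    by (simp add: G lessThan_atLeast0)
next
  case (Suc l)
  have "(dbar ^^ Suc l) G z = (\<Sum>k\<in>{l..<M}. (fact k / fact (k - l) * real (k - l)) *\<^sub>R
      act (conj_var z ^ (k - l - 1)) (g k z))"
    using dbar_polynomial[OF W Suc.prems, of "{l..<M}" g, OF _ Suc.IH] g Suc.prems by simp
  \<comment> \<open>The term \<open>k = l\<close>, constant in the conjugate variable, vanishes.\<close>
  also have "\<dots> = (\<Sum>k\<in>{Suc l..<M}. (fact k / fact (k - l) * real (k - l)) *\<^sub>R
      act (conj_var z ^ (k - l - 1)) (g k z))"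
    by (rule sum.mono_neutral_right) auto
  also have "\<dots> = (\<Sum>k\<in>{Suc l..<M}. (fact k / fact (k - Suc l)) *\<^sub>R
      act (conj_var z ^ (k - Suc l)) (g k z))"
  proof (intro sum.cong refl)
    fix k assume "k \<in> {Suc l..<M}"
    then have "k - l = Suc (k - Suc l)"
      by auto
    then show "(fact k / fact (k - l) * real (k - l)) *\<^sub>R act (conj_var z ^ (k - l - 1)) (g k z) =
        (fact k / fact (k - Suc l)) *\<^sub>R act (conj_var z ^ (k - Suc l)) (g k z)"
      by simp
  qed
  finally show ?case .
qed

lemma power_minus_scaleR: "(- x) ^ n = (-1) ^ n *\<^sub>R (x ^ n :: 'a)"
  by (induction n) auto

text \<open>The re-expansion of \<open>G\<close> by its Taylor formula. In the application \<open>\<Phi> m\<close> multiplies by the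
  resolvent and by the \<open>m\<close>-th power of the conjugate operator, and \<open>a\<close> is \<open>ds\<^sub>j\<close>. The powers of the
  conjugate variable on both sides of \<open>a\<close> have exponents \<open>l - m\<close> and \<open>k - l\<close>; their sum \<open>k - m\<close> does
  not depend on \<open>l\<close>, so the sum over \<open>l\<close> involves the binomial coefficients alone.\<close>

lemma taylor_re_expansion:
  fixes \<Phi> :: "nat \<Rightarrow> 'a \<Rightarrow> 'b::real_vector"
  assumes W: "open W" "z \<in> W"
    and g: "\<And>k z. k < M \<Longrightarrow> z \<in> W \<Longrightarrow> CR_at (g k) z"
    and G: "\<And>z. z \<in> W \<Longrightarrow> G z = (\<Sum>k<M. act (conj_var z ^ k) (g k z))"
    and \<Phi>: "\<And>m. linear (\<Phi> m)"
    and a: "a * conj_var z = conj_var z * a"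
  shows "(\<Sum>l<M. (1 / fact l) *\<^sub>R (\<Sum>m\<le>l. real (l choose m) *\<^sub>R
      \<Phi> m (act ((- conj_var z) ^ (l - m)) (act a ((dbar ^^ l) G z))))) =
    (\<Sum>k<M. \<Phi> k (act a (g k z)))"
proof -
  let ?p = "conj_var z"
  have a': "act (?p ^ n) (act a x) = act a (act (?p ^ n) x)" for n x
    using power_commuting_commutes[OF a[symmetric], of n] by (simp add: act_act)
  have "\<Phi> m (act ((- ?p) ^ (l - m)) (act a ((dbar ^^ l) G z))) =
      (\<Sum>k\<in>{l..<M}. ((-1) ^ (l - m) * (fact k / fact (k - l))) *\<^sub>R
        \<Phi> m (act a (act (?p ^ (k - m)) (g k z))))" if "m \<le> l" for l m
  proof -
    have "act ((- ?p) ^ (l - m)) (act a ((dbar ^^ l) G z)) =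
        (\<Sum>k\<in>{l..<M}. ((-1) ^ (l - m) * (fact k / fact (k - l))) *\<^sub>R
          act a (act (?p ^ (l - m)) (act (?p ^ (k - l)) (g k z))))"
      by (simp add: dbar_power_polynomial[OF W(1) g G W(2)] power_minus_scaleR sum_right
          scaleR_left scaleR_right scaleR_sum_right a' mult_ac)
    also have "\<dots> = (\<Sum>k\<in>{l..<M}. ((-1) ^ (l - m) * (fact k / fact (k - l))) *\<^sub>R
          act a (act (?p ^ (k - m)) (g k z)))"
      by (intro sum.cong refl) (use that in \<open>simp add: act_conj_var_powers\<close>)
    finally show ?thesis
      by (simp add: linear_sum[OF \<Phi>] linear_scale[OF \<Phi>])
  qed
  then have "(\<Sum>l<M. (1 / fact l) *\<^sub>R (\<Sum>m\<le>l. real (l choose m) *\<^sub>R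
      \<Phi> m (act ((- ?p) ^ (l - m)) (act a ((dbar ^^ l) G z))))) =
    (\<Sum>l<M. (1 / fact l) *\<^sub>R (\<Sum>m\<le>l. real (l choose m) *\<^sub>R
      (\<Sum>k\<in>{l..<M}. ((-1) ^ (l - m) * (fact k / fact (k - l))) *\<^sub>R
        \<Phi> m (act a (act (?p ^ (k - m)) (g k z))))))"
    by simp
  also have "\<dots> = (\<Sum>k<M. \<Phi> k (act a (act (?p ^ (k - k)) (g k z))))"
    by (rule taylor_sum_diagonal)
  finally show ?thesis
    by (simp add: act_one)
qed

end


section \<open>The planes spanned by imaginary units\<close>

text \<open>The mixed terms of the square cancel in pairs, because the generators anticommute.\<close>

lemma imag_unit_square:
  fixes j :: "real ^ 'n::{finite,linorder}"
  assumes "j \<in> imag_sphere"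
  shows "imag_unit j * imag_unit j = - 1"
proof -
  let ?S = "\<Sum>l\<in>UNIV. \<Sum>m\<in>UNIV. (j $ l * j $ m) *\<^sub>R (cgen l * cgen m)"
  have sq: "imag_unit j * imag_unit j = ?S"
    by (simp add: cpara_def sum_product) (intro sum.cong refl, simp add: mult.commute)
  have "?S + ?S = ?S + (\<Sum>l\<in>UNIV. \<Sum>m\<in>UNIV. (j $ m * j $ l) *\<^sub>R (cgen m * cgen l))"
    by (intro arg_cong[of _ _ "(+) ?S"]) (rule sum.swap)
  also have "\<dots> = (\<Sum>l\<in>UNIV. \<Sum>m\<in>UNIV. (j $ l * j $ m) *\<^sub>R (cgen l * cgen m + cgen m * cgen l))"
    unfolding sum.distrib[symmetric]
    by (intro sum.cong refl) (simp add: scaleR_add_right mult.commute)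
  also have "\<dots> = (\<Sum>l\<in>UNIV. \<Sum>m\<in>UNIV. if l = m then (j $ l)\<^sup>2 *\<^sub>R (- (2 *\<^sub>R 1)) else 0)"
    by (intro sum.cong refl) (auto simp: cgen_anticommute cgen_square power2_eq_square scaleR_2)
  also have "\<dots> = (\<Sum>l\<in>UNIV. (j $ l)\<^sup>2) *\<^sub>R (- (2 *\<^sub>R (1 :: 'n cl)))"
    by (simp add: scaleR_sum_left sum_negf sum_distrib_right)
  also have "\<dots> = - (2 *\<^sub>R 1)"
    using assms by (simp add: imag_sphere_def)
  finally have "2 *\<^sub>R ?S = 2 *\<^sub>R (- 1)"
    by (simp add: scaleR_2)
  then show ?thesis
    unfolding sq by (subst (asm) scaleR_cancel_left) simp
qed

lemma cpara_slice: "cpara (slice j z) = Re z *\<^sub>R 1 + Im z *\<^sub>R imag_unit j"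
  by (simp add: cpara_def slice_def scaleR_sum_right)

lemma cpara_pconj_slice: "cpara (pconj (slice j z)) = Re z *\<^sub>R 1 - Im z *\<^sub>R imag_unit j"
  by (simp add: cpara_def pconj_def slice_def scaleR_sum_right sum_negf)

lemma plane_action_left:
  assumes "j \<in> imag_sphere"
  shows "plane_action (*) (imag_unit j)"
proof (intro plane_action.intro bounded_bilinear_mult plane_action_axioms.intro)
  show "a * (b * x) = a * b * x" for a b x :: "'a cl"
    by (rule mult.assoc[symmetric])
qed (simp_all add: imag_unit_square assms)

lemma plane_action_right:
  assumes "j \<in> imag_sphere"
  shows "plane_action (\<lambda>a x. x * a) (imag_unit j)"
proof (intro plane_action.intro bounded_bilinear.flip[OF bounded_bilinear_mult]
    plane_action_axioms.intro)
  show "x * b * a = x * (a * b)" if "a * b = b * a" for a b x :: "'a cl"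
    by (simp add: that mult.assoc)
qed (simp_all add: imag_unit_square assms)

text \<open>Axial symmetry reaches the points \<open>u + i\<bar>v\<bar>\<close>, with nonnegative imaginary part, for all
  imaginary units \<open>i\<close>. The points with negative imaginary part are obtained from \<open>- i\<close>.\<close>

lemma vimage_slice_subset_plane_set:
  fixes j :: "real ^ 'n::{finite,linorder}"
  assumes D: "axially_symmetric D" and j: "j \<in> imag_sphere"
  shows "slice j -` D \<subseteq> plane_set D"
proof
  fix z assume "z \<in> slice j -` D"
  then have z: "(Re z, Im z *\<^sub>R j) \<in> D"
    by (simp add: slice_def)
  have "norm j = 1"
    using j by (simp add: imag_sphere_def norm_vec_def L2_set_def)
  then have abs: "(Re z, \<bar>Im z\<bar> *\<^sub>R i) \<in> D" if "i \<in> imag_sphere" for i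
    using D z that unfolding axially_symmetric_def by fastforce
  have "slice i z \<in> D" if i: "i \<in> imag_sphere" for i
  proof -
    have "- i \<in> imag_sphere"
      using i by (simp add: imag_sphere_def)
    then show ?thesis
      using abs[OF i] abs[of "- i"] by (cases "Im z \<ge> 0") (auto simp: slice_def)
  qed
  then show "z \<in> plane_set D"
    by (simp add: plane_set_def)
qed

lemma continuous_on_slice: "continuous_on S (slice j)"
  unfolding slice_def[abs_def] by (intro continuous_intros)

lemma open_vimage_slice: "open D \<Longrightarrow> open (slice j -` D)"
  by (rule open_vimage[OF _ continuous_on_slice])

lemma path_image_subset_vimage_slice:
  assumes "oriented_boundary (slice j -` U) \<Gamma>" and "admissible K D U"
    and "\<gamma> \<in> \<Gamma>" and "t \<in> {0..1}"
  shows "\<gamma> t \<in> slice j -` D"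
proof -
  have "\<gamma> t \<in> frontier (slice j -` U)"
    using assms unfolding oriented_boundary_def path_image_def by blast
  also have "\<dots> \<subseteq> closure (slice j -` U)"
    by (simp add: frontier_def)
  also have "\<dots> \<subseteq> slice j -` closure U"
    by (intro closure_minimal closed_vimage continuous_on_slice) (use closure_subset in auto)
  also have "\<dots> \<subseteq> slice j -` D"
    using assms(2) by (auto simp: admissible_def)
  finally show ?thesis .
qed

text \<open>The Cauchy-Riemann equation is known for \<open>F\<^sub>0 + j F\<^sub>1\<close> on \<open>plane_set D\<close>. It passes to \<open>f\<close> because
  the two functions agree on an open set around the point, namely the slice of \<open>D\<close>.\<close>

lemma slice_monogenic_L_CR_at:
  assumes f: "slice_monogenic_L D f" and j: "j \<in> imag_sphere" and z: "z \<in> slice j -` D"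
  shows "plane_action.CR_at (*) (imag_unit j) (f \<circ> slice j) z"
proof -
  interpret plane_action "(*)" "imag_unit j"
    using j by (rule plane_action_left)
  from f obtain F0 F1 where D: "open D" "axially_symmetric D"
    and F: "Ck_on 1 (plane_set D) F0" "Ck_on 1 (plane_set D) F1"
    and eq: "\<And>w. w \<in> plane_set D \<Longrightarrow> f (slice j w) = F0 w + imag_unit j * F1 w"
    and CR: "\<And>w. w \<in> plane_set D \<Longrightarrow> dbar_L j (\<lambda>w. F0 w + imag_unit j * F1 w) w = 0"
    using j unfolding poly_slice_monogenic_L_def by auto
  note sub = vimage_slice_subset_plane_set[OF D(2) j]
  let ?H = "\<lambda>w. F0 w + imag_unit j * F1 w"
  have "has_partials ?H (d_u F0 z + imag_unit j * d_u F1 z) (d_v F0 z + imag_unit j * d_v F1 z) z"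
    using Ck_on_1_imp_has_partials[OF F(1)] Ck_on_1_imp_has_partials[OF F(2)] sub z
    unfolding has_partials_def
    by (auto intro!: has_vector_derivative_add has_vector_derivative_mult_right)
  then have H: "has_partials ?H (d_u ?H z) (d_v ?H z) z"
    by (simp add: has_partials_imp_d_u has_partials_imp_d_v)
  then have "has_partials (f \<circ> slice j) (d_u ?H z) (d_v ?H z) z"
    by (rule has_partials_transform_open[OF _ open_vimage_slice[OF D(1)] z]) (use sub eq in auto)
  moreover have "d_u ?H z + imag_unit j * d_v ?H z = 0"
    using CR[of z] sub z by (auto simp: dbar_L_def)
  ultimately show ?thesis
    unfolding CR_at_def by blast
qed

lemma slice_monogenic_R_CR_at:
  assumes f: "slice_monogenic_R D f" and j: "j \<in> imag_sphere" and z: "z \<in> slice j -` D"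
  shows "plane_action.CR_at (\<lambda>a x. x * a) (imag_unit j) (f \<circ> slice j) z"
proof -
  interpret plane_action "\<lambda>a x. x * a" "imag_unit j"
    using j by (rule plane_action_right)
  from f obtain F0 F1 where D: "open D" "axially_symmetric D"
    and F: "Ck_on 1 (plane_set D) F0" "Ck_on 1 (plane_set D) F1"
    and eq: "\<And>w. w \<in> plane_set D \<Longrightarrow> f (slice j w) = F0 w + F1 w * imag_unit j"
    and CR: "\<And>w. w \<in> plane_set D \<Longrightarrow> dbar_R j (\<lambda>w. F0 w + F1 w * imag_unit j) w = 0"
    using j unfolding poly_slice_monogenic_R_def by auto
  note sub = vimage_slice_subset_plane_set[OF D(2) j]
  let ?H = "\<lambda>w. F0 w + F1 w * imag_unit j"
  have "has_partials ?H (d_u F0 z + d_u F1 z * imag_unit j) (d_v F0 z + d_v F1 z * imag_unit j) z"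
    using Ck_on_1_imp_has_partials[OF F(1)] Ck_on_1_imp_has_partials[OF F(2)] sub z
    unfolding has_partials_def
    by (auto intro!: has_vector_derivative_add has_vector_derivative_mult_left)
  then have H: "has_partials ?H (d_u ?H z) (d_v ?H z) z"
    by (simp add: has_partials_imp_d_u has_partials_imp_d_v)
  then have "has_partials (f \<circ> slice j) (d_u ?H z) (d_v ?H z) z"
    by (rule has_partials_transform_open[OF _ open_vimage_slice[OF D(1)] z]) (use sub eq in auto)
  moreover have "d_u ?H z + d_v ?H z * imag_unit j = 0"
    using CR[of z] sub z by (auto simp: dbar_R_def)
  ultimately show ?thesis
    unfolding CR_at_def by blast
qed


section \<open>Equality of the integrands\<close>

lemma linear_clop_of: "linear clop_of"
  by (rule linearI; rule clifford_eqI)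
     (simp_all add: clop_of_def Clifford_inverse plus_clifford.rep_eq scaleR_clifford.rep_eq
        scaleR_add_left)

lemma clop_of_mult: "clop_of (a * b) = clop_of a * clop_of b"
  by (rule clifford_eqI)
     (simp add: clop_of_def Clifford_inverse times_clifford.rep_eq cl_conv_alt scaleR_sum_left
        mult_ac)

text \<open>Only values of \<open>ds\<^sub>j\<close> in \<open>\<complex>\<^sub>j\<close> occur in the integral; \<open>ds_commutes_conj\<close> depends on this.\<close>

lemma slice_integral_cong:
  assumes "\<And>\<gamma> t w. \<gamma> \<in> \<Gamma> \<Longrightarrow> t \<in> {0..1} \<Longrightarrow>
    H (\<gamma> t) (cpara (slice j w) * (- imag_unit j)) = H' (\<gamma> t) (cpara (slice j w) * (- imag_unit j))"
  shows "slice_integral j \<Gamma> H = slice_integral j \<Gamma> H'"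
  unfolding slice_integral_def by (intro sum.cong refl integral_cong assms)

lemma ds_commutes_conj:
  "(cpara (slice j w) * (- imag_unit j)) * cpara (pconj (slice j z)) =
   cpara (pconj (slice j z)) * (cpara (slice j w) * (- imag_unit j))"
  by (simp add: cpara_slice cpara_pconj_slice algebra_simps)

lemma integrand_L:
  fixes T :: "('v::banach, 'n::{finite,linorder}) clop"
  assumes j: "j \<in> imag_sphere" and F: "components_L M D F f" and D: "open D"
    and z: "z \<in> slice j -` D"
    and ds: "ds * cpara (pconj (slice j z)) = cpara (pconj (slice j z)) * ds"
  shows "(\<Sum>l<M. Pi_S_L l (slice j z) T * clop_of ds * clop_of ((dbar_L j ^^ l) (F \<circ> slice j) z)) =
    (\<Sum>l<M. op_conj T ^ l * S_L (slice j z) T * clop_of ds * clop_of (f l (slice j z)))"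
proof -
  interpret plane_action "(*)" "imag_unit j"
    using j by (rule plane_action_left)
  have conj: "cpara (pconj (slice j w)) = conj_var w" for w
    by (simp add: conj_var_def cpara_pconj_slice)
  have dbar: "dbar_L j = dbar"
    by (simp add: fun_eq_iff dbar_L_def dbar_def)
  define \<Phi> where "\<Phi> m x = op_conj T ^ m * S_L (slice j z) T * clop_of x" for m x
  have "linear (\<Phi> m)" for m
    unfolding \<Phi>_def
    by (rule linearI)
       (simp_all add: linear_add[OF linear_clop_of] linear_scale[OF linear_clop_of] algebra_simps)
  moreover have "CR_at (f k \<circ> slice j) w" if "k < M" "w \<in> slice j -` D" for k w
    using F that j slice_monogenic_L_CR_at unfolding components_L_def by blast
  moreover have "(F \<circ> slice j) w = (\<Sum>k<M. conj_var w ^ k * (f k \<circ> slice j) w)"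
    if "w \<in> slice j -` D" for w
    using F that by (simp add: components_L_def conj)
  ultimately have "(\<Sum>l<M. (1 / fact l) *\<^sub>R (\<Sum>m\<le>l. real (l choose m) *\<^sub>R
      \<Phi> m ((- conj_var z) ^ (l - m) * (ds * (dbar ^^ l) (F \<circ> slice j) z)))) =
    (\<Sum>k<M. \<Phi> k (ds * (f k \<circ> slice j) z))"
    using ds by (intro taylor_re_expansion[OF open_vimage_slice[OF D] z, where g = "\<lambda>k. f k \<circ> slice j"])
      (simp_all only: conj)
  then show ?thesis
    by (simp add: Pi_S_L_def \<Phi>_def conj dbar clop_of_mult sum_distrib_right mult.assoc)
qed

lemma integrand_R:
  fixes T :: "('v::banach, 'n::{finite,linorder}) clop"
  assumes j: "j \<in> imag_sphere" and F: "components_R M D F f" and D: "open D"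
    and z: "z \<in> slice j -` D"
    and ds: "ds * cpara (pconj (slice j z)) = cpara (pconj (slice j z)) * ds"
  shows "(\<Sum>l<M. clop_of ((dbar_R j ^^ l) (F \<circ> slice j) z) * clop_of ds * Pi_S_R l (slice j z) T) =
    (\<Sum>l<M. clop_of (f l (slice j z)) * clop_of ds * S_R (slice j z) T * op_conj T ^ l)"
proof -
  interpret plane_action "\<lambda>a x. x * a" "imag_unit j"
    using j by (rule plane_action_right)
  have conj: "cpara (pconj (slice j w)) = conj_var w" for w
    by (simp add: conj_var_def cpara_pconj_slice)
  have dbar: "dbar_R j = dbar"
    by (simp add: fun_eq_iff dbar_R_def dbar_def)
  define \<Phi> where "\<Phi> m x = clop_of x * (S_R (slice j z) T * op_conj T ^ m)" for m x
  have "linear (\<Phi> m)" for m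
    unfolding \<Phi>_def
    by (rule linearI)
       (simp_all add: linear_add[OF linear_clop_of] linear_scale[OF linear_clop_of] algebra_simps)
  moreover have "CR_at (f k \<circ> slice j) w" if "k < M" "w \<in> slice j -` D" for k w
    using F that j slice_monogenic_R_CR_at unfolding components_R_def by blast
  moreover have "(F \<circ> slice j) w = (\<Sum>k<M. (f k \<circ> slice j) w * conj_var w ^ k)"
    if "w \<in> slice j -` D" for w
    using F that by (simp add: components_R_def conj)
  ultimately have "(\<Sum>l<M. (1 / fact l) *\<^sub>R (\<Sum>m\<le>l. real (l choose m) *\<^sub>R
      \<Phi> m (((dbar ^^ l) (F \<circ> slice j) z * ds) * (- conj_var z) ^ (l - m)))) =
    (\<Sum>k<M. \<Phi> k ((f k \<circ> slice j) z * ds))"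
    using ds by (intro taylor_re_expansion[OF open_vimage_slice[OF D] z, where g = "\<lambda>k. f k \<circ> slice j"])
      (simp_all only: conj)
  then show ?thesis
    by (simp add: Pi_S_R_def \<Phi>_def conj dbar clop_of_mult sum_distrib_left mult.assoc)
qed

theorem theorem7p1:
  fixes T :: "('v::banach, 'n::{finite,linorder}) clop" and M :: nat
  assumes "paravector_op T" and "M \<ge> 1"
  shows
    "(\<forall>D F f U j \<Gamma>.
        (D, F) \<in> PS_L M (S_spectrum T) \<longrightarrow> components_L M D F f \<longrightarrow>
        admissible (S_spectrum T) D U \<longrightarrow> j \<in> imag_sphere \<longrightarrow>
        oriented_boundary (slice j -` U) \<Gamma> \<longrightarrow>
        (1 / (2 * pi)) *\<^sub>R slice_integral j \<Gamma> (\<lambda>z ds. \<Sum>l<M.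
            Pi_S_L l (slice j z) T * clop_of ds * clop_of ((dbar_L j ^^ l) (F \<circ> slice j) z)) =
        (1 / (2 * pi)) *\<^sub>R slice_integral j \<Gamma> (\<lambda>z ds. \<Sum>l<M.
            op_conj T ^ l * S_L (slice j z) T * clop_of ds * clop_of (f l (slice j z)))) \<and>
     (\<forall>D F f U j \<Gamma>.
        (D, F) \<in> PS_R M (S_spectrum T) \<longrightarrow> components_R M D F f \<longrightarrow>
        admissible (S_spectrum T) D U \<longrightarrow> j \<in> imag_sphere \<longrightarrow>
        oriented_boundary (slice j -` U) \<Gamma> \<longrightarrow>
        (1 / (2 * pi)) *\<^sub>R slice_integral j \<Gamma> (\<lambda>z ds. \<Sum>l<M.
            clop_of ((dbar_R j ^^ l) (F \<circ> slice j) z) * clop_of ds * Pi_S_R l (slice j z) T) =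
        (1 / (2 * pi)) *\<^sub>R slice_integral j \<Gamma> (\<lambda>z ds. \<Sum>l<M.
            clop_of (f l (slice j z)) * clop_of ds * S_R (slice j z) T * op_conj T ^ l))"
proof (intro conjI allI impI)
  fix D F f U j \<Gamma>
  assume "(D, F) \<in> PS_L M (S_spectrum T)" and F: "components_L M D F f"
    and U: "admissible (S_spectrum T) D U" and j: "j \<in> imag_sphere"
    and \<Gamma>: "oriented_boundary (slice j -` U) \<Gamma>"
  then have "open D"
    by (simp add: PS_L_def poly_slice_monogenic_L_def)
  then show "(1 / (2 * pi)) *\<^sub>R slice_integral j \<Gamma> (\<lambda>z ds. \<Sum>l<M.
      Pi_S_L l (slice j z) T * clop_of ds * clop_of ((dbar_L j ^^ l) (F \<circ> slice j) z)) =
    (1 / (2 * pi)) *\<^sub>R slice_integral j \<Gamma> (\<lambda>z ds. \<Sum>l<M.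
      op_conj T ^ l * S_L (slice j z) T * clop_of ds * clop_of (f l (slice j z)))"
    using path_image_subset_vimage_slice[OF \<Gamma> U]
    by (intro arg_cong[of _ _ "scaleR _"] slice_integral_cong integrand_L[OF j F] ds_commutes_conj)
next
  fix D F f U j \<Gamma>
  assume "(D, F) \<in> PS_R M (S_spectrum T)" and F: "components_R M D F f"
    and U: "admissible (S_spectrum T) D U" and j: "j \<in> imag_sphere"
    and \<Gamma>: "oriented_boundary (slice j -` U) \<Gamma>"
  then have "open D"
    by (simp add: PS_R_def poly_slice_monogenic_R_def)
  then show "(1 / (2 * pi)) *\<^sub>R slice_integral j \<Gamma> (\<lambda>z ds. \<Sum>l<M.
      clop_of ((dbar_R j ^^ l) (F \<circ> slice j) z) * clop_of ds * Pi_S_R l (slice j z) T) =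
    (1 / (2 * pi)) *\<^sub>R slice_integral j \<Gamma> (\<lambda>z ds. \<Sum>l<M.
      clop_of (f l (slice j z)) * clop_of ds * S_R (slice j z) T * op_conj T ^ l)"
    using path_image_subset_vimage_slice[OF \<Gamma> U]
    by (intro arg_cong[of _ _ "scaleR _"] slice_integral_cong integrand_R[OF j F] ds_commutes_conj)
qed

end
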